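(* Let $G$ be an $n$-vertex graph without isolated vertices and let $\ell:V(G)\to\mathbb{F}_2$ be any labelling. Then $$h_\ell(G)\ \ge\ \max\left\{\frac{\gamma(G)}{2},\ \frac{n-\gamma(G)}{4}\right\}.$$ In particular, $h_\ell(G)\ge n/6$, and therefore $f_{\mathrm{oe}}(G)\ge n/6$.
   Context: All graphs are finite and simple (no loops, no multiple edges). For $S\subseteq V(G)$ and $v\in V(G)$ write $d_S(v,G)=|N_G(v)\cap S|$. Given a labelling $\ell:V(G)\to\mathbb{F}_2$, a set $S\subseteq V(G)$ is called $\ell$-admissible if $d_S(v,G)\equiv \ell(v)\pmod 2$ for every $v\in S$ (the empty set is vacuously admissible). Define $h_\ell(G)=\max\{|S|: S\subseteq V(G)\text{ is }\ell\text{-admissible}\}$ and $f_{\mathrm{oe}}(G)=\min_{\ell:V(G)\to\mathbb{F}_2}h_\ell(G)$. $\gamma(G)$ is the domination number of $G$, i.e. the minimum size of a set $D\subseteq V(G)$ such that every vertex of $V(G)\setminus D$ has a neighbour in $D$. *)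

theory Defs
  imports "Graph_Theory.Pair_Digraph" "HOL-Library.Z2"
begin

text \<open>
  Finite simple graphs are the locale predicate \<^const>\<open>pair_graph\<close>: a finite vertex set
  together with a symmetric, irreflexive set of ordered pairs of vertices.
  The field of two elements is the type \<^typ>\<open>bit\<close>.
\<close>

definition nbhd :: "'a pair_pre_digraph \<Rightarrow> 'a \<Rightarrow> 'a set" where
  "nbhd G v = {u. (v, u) \<in> parcs G}"

definition isolated :: "'a pair_pre_digraph \<Rightarrow> 'a \<Rightarrow> bool" where
  "isolated G v \<longleftrightarrow> v \<in> pverts G \<and> nbhd G v = {}"

definition deg_in :: "'a set \<Rightarrow> 'a \<Rightarrow> 'a pair_pre_digraph \<Rightarrow> nat" where
  "deg_in S v G = card (nbhd G v \<inter> S)"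

text \<open>
  The congruence modulo 2 is an equation in \<^typ>\<open>bit\<close>. Labellings are total functions on the
  type \<^typ>\<open>'a\<close>, but admissibility only looks at their values on the vertex set.
\<close>

definition admissible :: "('a \<Rightarrow> bit) \<Rightarrow> 'a pair_pre_digraph \<Rightarrow> 'a set \<Rightarrow> bool" where
  "admissible l G S \<longleftrightarrow> S \<subseteq> pverts G \<and> (\<forall>v\<in>S. of_nat (deg_in S v G) = l v)"

definition h_num :: "('a \<Rightarrow> bit) \<Rightarrow> 'a pair_pre_digraph \<Rightarrow> nat" where
  "h_num l G = Max {card S | S. admissible l G S}"

definition f_oe :: "'a pair_pre_digraph \<Rightarrow> nat" where
  "f_oe G = Min {h_num l G | l. True}"

definition dominating :: "'a pair_pre_digraph \<Rightarrow> 'a set \<Rightarrow> bool" where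
  "dominating G D \<longleftrightarrow> D \<subseteq> pverts G \<and> (\<forall>v \<in> pverts G - D. nbhd G v \<inter> D \<noteq> {})"

definition domination_number :: "'a pair_pre_digraph \<Rightarrow> nat" where
  "domination_number G = Min {card D | D. dominating G D}"

text \<open>
  \<^const>\<open>Max\<close> and \<^const>\<open>Min\<close> are meaningful only on finite nonempty sets; on finite
  graphs all three extrema above are attained.
\<close>

context pair_graph
begin

lemma finite_admissible_cards: "finite {card S | S. admissible l G S}"
  by (rule finite_subset[of _ "card ` Pow (pverts G)"]) (auto simp: admissible_def)

lemma h_num_attained: "\<exists>S. admissible l G S \<and> card S = h_num l G"
proof -
  have "admissible l G {}" by (simp add: admissible_def)
  then have "{card S | S. admissible l G S} \<noteq> {}" by blast
  from Max_in[OF finite_admissible_cards this] show ?thesis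
    unfolding h_num_def by auto
qed

lemma h_num_le_card: "h_num l G \<le> card (pverts G)"
  using h_num_attained[of l] by (metis admissible_def card_mono pair_finite_verts)

lemma f_oe_attained: "\<exists>l. h_num l G = f_oe G"
proof -
  have "finite {h_num l G | l. True}"
    by (rule finite_subset[of _ "{..card (pverts G)}"]) (auto simp: h_num_le_card)
  moreover have "{h_num l G | l. True} \<noteq> {}" by blast
  ultimately have "f_oe G \<in> {h_num l G | l. True}"
    unfolding f_oe_def by (rule Min_in)
  then show ?thesis by auto
qed

lemma domination_number_attained: "\<exists>D. dominating G D \<and> card D = domination_number G"
proof -
  have "finite {card D | D. dominating G D}"
    by (rule finite_subset[of _ "card ` Pow (pverts G)"]) (auto simp: dominating_def)
  moreover have "dominating G (pverts G)" by (simp add: dominating_def)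
  then have "{card D | D. dominating G D} \<noteq> {}" by blast
  ultimately have "domination_number G \<in> {card D | D. dominating G D}"
    unfolding domination_number_def by (rule Min_in)
  then show ?thesis by auto
qed

end

end

theory Submission
  imports Defs
begin

text \<open>
  Call disjoint sets \<open>A\<close>, \<open>B\<close> balanced if every \<open>a \<in> A\<close> has \<open>l a\<close> neighbours in \<open>B\<close> and every
  \<open>b \<in> B\<close> has \<open>l b\<close> neighbours in \<open>A\<close>, modulo 2. If \<open>E\<close> and its complement in \<open>A \<union> B\<close> both induce
  even degrees (Gallai), then the symmetric difference of \<open>A\<close> and \<open>E\<close> and its complement in
  \<open>A \<union> B\<close> are both \<open>l\<close>-admissible, so \<open>h\<^sub>l(G) \<ge> |A \<union> B| / 2\<close>.

  Suppose now only that \<open>W\<close>, \<open>T\<close> are disjoint and every \<open>w \<in> W\<close> has \<open>l w\<close> neighbours in \<open>T\<close>. For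
  \<open>T\<close> minimal with this property the rows of the \<open>T \<times> W\<close> adjacency matrix are independent, so at
  most \<open>|T|\<close> vertices of \<open>W\<close> can be deleted to make the pair balanced; hence \<open>h\<^sub>l(G) \<ge> |W| / 2\<close>.

  For the bound \<open>\<gamma> / 2\<close>, let \<open>W\<close> consist of external private neighbours of the vertices of a minimum
  dominating set \<open>D\<close> (Bollobas--Cockayne), and \<open>T\<close> of those vertices of \<open>D\<close> whose private neighbour
  has label 1. For the bound \<open>(n - \<gamma>) / 4\<close>, a suitable \<open>T \<subseteq> D\<close> is right for at least half of the
  vertices outside \<open>D\<close>.
\<close>

section \<open>Linear algebra over the field of two elements\<close>

text \<open>These two simplification rules turn field operations into bit operations, out of reach of the
  lemmas on sums.\<close>

declare add_bit_eq_xor [simp del] mult_bit_eq_and [simp del]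

lemma bit_mult_self [simp]: "x * x = (x :: bit)"
  by (cases x) auto

lemma bit_add_self [simp]: "x + x = (0 :: bit)"
  by (cases x) (auto simp: add_bit_eq_xor)

lemma bit_add_self_left [simp]: "x + (x + y) = (y :: bit)"
  by (simp add: add.assoc[symmetric])

lemma bit_add_eq_0_iff: "x + y = (0 :: bit) \<longleftrightarrow> x = y"
  by (cases x; cases y) auto

text \<open>Eliminating a diagonal pivot keeps the matrix symmetric. As \<open>x * x = x\<close>,
  the diagonal of the Schur complement is the old diagonal reduced by the same elimination, so
  induction applies.\<close>

lemma symmetric_matrix_diagonal_in_range:
  fixes a :: "'a \<Rightarrow> 'a \<Rightarrow> bit"
  assumes "finite X" and "\<And>u v. a u v = a v u"
  shows "\<exists>E\<subseteq>X. \<forall>v\<in>X. (\<Sum>u\<in>E. a v u) = a v v"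
  using assms
proof (induction "card X" arbitrary: X a rule: less_induct)
  case less
  show ?case
  proof (cases "\<forall>v\<in>X. a v v = 0")
    case True
    then show ?thesis by (intro exI[of _ "{}"]) auto
  next
    case False
    then obtain v where v: "v \<in> X" "a v v = 1" by auto
    \<comment> \<open>Schur complement with respect to the pivot \<open>v\<close>\<close>
    define b where "b = (\<lambda>u w. a u w + a u v * a v w)"
    have sym: "a u w = a w u" for u w by (rule less.prems(2))
    have bsym: "b u w = b w u" for u w
      unfolding b_def by (metis sym mult.commute)
    have "card (X - {v}) < card X"
      using v less.prems(1) by (meson card_Diff1_less)
    then have "\<exists>F\<subseteq>X - {v}. \<forall>u\<in>X - {v}. (\<Sum>w\<in>F. b u w) = b u u"
      using less.prems(1) bsym by (intro less.hyps[of "X - {v}" b]) auto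
    then obtain F where F: "F \<subseteq> X - {v}" "\<And>u. u \<in> X - {v} \<Longrightarrow> (\<Sum>w\<in>F. b u w) = b u u"
      by blast
    have finF: "finite F" using F(1) less.prems(1) by (meson finite_Diff finite_subset)
    have vF: "v \<notin> F" using F(1) by auto
    define s where "s = (\<Sum>w\<in>F. a v w)"
    have row: "(\<Sum>w\<in>F. a u w) + a u v * s = a u u + a u v" if "u \<in> X - {v}" for u
      using F(2)[OF that] sym[of v u]
      by (simp add: b_def sum.distrib sum_distrib_left s_def)
    \<comment> \<open>Row \<open>v\<close> must sum to \<open>a v v = 1\<close>, so \<open>v\<close>
      enters exactly when \<open>F\<close> alone gives 0 there.\<close>
    define E where "E = (if s = 0 then insert v F else F)"
    have sumE: "(\<Sum>w\<in>E. a u w) = (\<Sum>w\<in>F. a u w) + a u v * (1 + s)" for u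
      using finF vF by (cases s) (auto simp: E_def add.commute)
    have "(\<Sum>w\<in>E. a u w) = a u u" if "u \<in> X" for u
    proof (cases "u = v")
      case True
      then show ?thesis using v(2) unfolding sumE s_def[symmetric]
        by (cases s) (auto simp: s_def[symmetric])
    next
      case False
      then show ?thesis using row[of u] that unfolding sumE
        by (cases s; cases "a u v") (auto simp: algebra_simps)
    qed
    moreover have "E \<subseteq> X" using F(1) v by (auto simp: E_def)
    ultimately show ?thesis by blast
  qed
qed

text \<open>Independent rows mean full row rank, so the columns span everything. Elimination spends
  at most one column per row, which bounds \<open>card B\<close>.\<close>

lemma independent_rows_column_span:
  fixes a :: "'a \<Rightarrow> 'b \<Rightarrow> bit"
  assumes "finite T" and "finite W"
    and "\<And>R. R \<subseteq> T \<Longrightarrow> R \<noteq> {} \<Longrightarrow> \<exists>w\<in>W. (\<Sum>t\<in>R. a t w) \<noteq> 0"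
  shows "\<exists>B\<subseteq>W. card B \<le> card T \<and> (\<forall>t\<in>T. (\<Sum>w\<in>B. a t w) = f t)"
  using assms
proof (induction T arbitrary: a f rule: finite_induct)
  case empty
  then show ?case by (intro exI[of _ "{}"]) auto
next
  case (insert t T)
  obtain w where w: "w \<in> W" "a t w = 1"
    using insert.prems(2)[of "{t}"] by auto
  \<comment> \<open>Clear column \<open>w\<close> outside row \<open>t\<close>.\<close>
  define b where "b = (\<lambda>r u. a r u + a r w * a t u)"
  have "\<exists>u\<in>W. (\<Sum>r\<in>R. b r u) \<noteq> 0" if R: "R \<subseteq> T" "R \<noteq> {}" for R
  proof -
    have fR: "finite R" and tR: "t \<notin> R"
      using R(1) insert.hyps by (auto intro: finite_subset)
    define k where "k = (\<Sum>r\<in>R. a r w)"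
    \<comment> \<open>Rows of \<open>b\<close> differ from rows of \<open>a\<close> by multiples of
      row \<open>t\<close>, so a vanishing sum over \<open>R\<close> would be one over
      \<open>R'\<close> in \<open>a\<close>.\<close>
    define R' where "R' = (if k = 0 then R else insert t R)"
    have "(\<Sum>r\<in>R. b r u) = (\<Sum>r\<in>R'. a r u)" for u
    proof -
      have "(\<Sum>r\<in>R. b r u) = (\<Sum>r\<in>R. a r u) + k * a t u"
        by (simp add: b_def k_def sum.distrib sum_distrib_right)
      then show ?thesis
        using fR tR by (cases k) (auto simp: R'_def add.commute)
    qed
    moreover have "R' \<subseteq> insert t T" "R' \<noteq> {}" using R by (auto simp: R'_def)
    ultimately show ?thesis using insert.prems(2)[of R'] by simp
  qed
  from insert.IH[OF insert.prems(1) this, of "\<lambda>r. f r + a r w * f t"]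
  obtain C where C: "C \<subseteq> W" "card C \<le> card T"
    "\<And>r. r \<in> T \<Longrightarrow> (\<Sum>u\<in>C. b r u) = f r + a r w * f t"
    by blast
  have fC: "finite C" using C(1) insert.prems(1) by (rule finite_subset)
  define s where "s = (\<Sum>u\<in>C. a t u)"
  have row: "(\<Sum>u\<in>C. a r u) + a r w * s = f r + a r w * f t" if "r \<in> T" for r
    using C(3)[OF that] by (simp add: b_def s_def sum.distrib sum_distrib_left)
  \<comment> \<open>Toggling \<open>w\<close> repairs row \<open>t\<close>, where
    \<open>a t w = 1\<close>; its effect on the other rows is what the reduced right-hand side
    anticipates.\<close>
  define B where "B = (if s = f t then C else if w \<in> C then C - {w} else insert w C)"
  have sumB: "(\<Sum>u\<in>B. a r u) = (\<Sum>u\<in>C. a r u) + a r w * (s + f t)" for r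
  proof (cases "s = f t")
    case True
    then show ?thesis by (simp add: B_def)
  next
    case False
    then have "s + f t = 1" by (cases s; cases "f t") auto
    moreover have "(\<Sum>u\<in>B. a r u) = (\<Sum>u\<in>C. a r u) + a r w"
      using False fC sum.remove[of C w "a r"] by (auto simp: B_def add.commute add.left_commute)
    ultimately show ?thesis by simp
  qed
  have "(\<Sum>u\<in>B. a r u) = f r" if "r \<in> insert t T" for r
  proof (cases "r = t")
    case True
    then show ?thesis using w(2) by (simp add: sumB s_def[symmetric] add.assoc[symmetric])
  next
    case False
    then show ?thesis using row[of r] that unfolding sumB
      by (cases s; cases "f t"; cases "a r w") (auto simp: algebra_simps)
  qed
  moreover have "B \<subseteq> W" using C(1) w(1) by (auto simp: B_def)
  moreover have "card B \<le> card (insert t T)"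
    using C(2) fC insert.hyps by (auto simp: B_def card_insert_if)
  ultimately show ?case by blast
qed

section \<open>Parities of degrees\<close>

definition adj :: "'a pair_pre_digraph \<Rightarrow> 'a \<Rightarrow> 'a \<Rightarrow> bit" where
  "adj G v u = of_bool ((v, u) \<in> parcs G)"

context pair_graph
begin

lemma adj_sym: "adj G u v = adj G v u"
  by (auto simp: adj_def arcs_symmetric)

lemma adj_irrefl [simp]: "adj G v v = 0"
  by (auto simp: adj_def dest: no_loops')

lemma of_nat_deg_in: "finite S \<Longrightarrow> of_nat (deg_in S v G) = (\<Sum>u\<in>S. adj G v u)"
proof -
  assume "finite S"
  then have "(\<Sum>u\<in>S. adj G v u) = of_nat (card {u\<in>S. (v, u) \<in> parcs G})"
    by (simp add: adj_def sum.If_cases of_bool_def Int_def)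
  moreover have "nbhd G v \<inter> S = {u\<in>S. (v, u) \<in> parcs G}" by (auto simp: nbhd_def)
  ultimately show ?thesis by (simp add: deg_in_def)
qed

lemma admissible_card_le: "admissible l G S \<Longrightarrow> card S \<le> h_num l G"
  unfolding h_num_def by (rule Max_ge[OF finite_admissible_cards]) blast

lemma domination_number_le: "dominating G D \<Longrightarrow> domination_number G \<le> card D"
proof -
  assume "dominating G D"
  moreover have "finite {card D | D. dominating G D}"
    by (rule finite_subset[of _ "card ` Pow (pverts G)"]) (auto simp: dominating_def)
  ultimately show ?thesis unfolding domination_number_def by (intro Min_le) auto
qed

text \<open>Put the degrees within \<open>X\<close> on the diagonal of the adjacency matrix and let
  the columns in \<open>E\<close> sum to that diagonal. The row of \<open>v\<close> then forces an
  even degree into \<open>E\<close> if \<open>v \<in> E\<close>, and into \<open>X - E\<close>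
  otherwise.\<close>

lemma gallai_even_partition:
  assumes "finite X"
  shows "\<exists>E\<subseteq>X. (\<forall>v\<in>E. (\<Sum>u\<in>E. adj G v u) = 0) \<and> (\<forall>v\<in>X - E. (\<Sum>u\<in>X - E. adj G v u) = 0)"
proof -
  define d where "d v = (\<Sum>u\<in>X. adj G v u)" for v
  define m where "m = (\<lambda>u v. adj G u v + (if u = v then d u else 0))"
  have "m u v = m v u" for u v by (auto simp: m_def adj_sym)
  from symmetric_matrix_diagonal_in_range[where a = m, OF assms this]
  obtain E where E: "E \<subseteq> X" "\<And>v. v \<in> X \<Longrightarrow> (\<Sum>u\<in>E. m v u) = m v v" by blast
  have fE: "finite E" using E(1) assms by (rule finite_subset)
  have row: "(\<Sum>u\<in>E. adj G v u) + (if v \<in> E then d v else 0) = d v" if "v \<in> X" for v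
    using E(2)[OF that] fE by (simp add: m_def sum.distrib)
  have split: "d v = (\<Sum>u\<in>X - E. adj G v u) + (\<Sum>u\<in>E. adj G v u)" for v
    unfolding d_def by (rule sum.subset_diff[OF E(1) assms])
  have "(\<Sum>u\<in>E. adj G v u) = 0" if "v \<in> E" for v
    using row[of v] that E(1) by auto
  moreover have "(\<Sum>u\<in>X - E. adj G v u) = 0" if "v \<in> X - E" for v
    using row[of v] split[of v] that by auto
  ultimately show ?thesis using E(1) by blast
qed

lemma balanced_pair_card_le:
  assumes sub: "A \<subseteq> pverts G" "B \<subseteq> pverts G" and disj: "A \<inter> B = {}"
    and A: "\<And>v. v \<in> A \<Longrightarrow> (\<Sum>u\<in>B. adj G v u) = l v"
    and B: "\<And>v. v \<in> B \<Longrightarrow> (\<Sum>u\<in>A. adj G v u) = l v"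
  shows "card A + card B \<le> 2 * h_num l G"
proof -
  have fin: "finite A" "finite B" using sub pair_finite_verts by (auto intro: finite_subset)
  obtain E where E: "E \<subseteq> A \<union> B" "\<And>v. v \<in> E \<Longrightarrow> (\<Sum>u\<in>E. adj G v u) = 0"
    "\<And>v. v \<in> A \<union> B - E \<Longrightarrow> (\<Sum>u\<in>A \<union> B - E. adj G v u) = 0"
    using gallai_even_partition[of "A \<union> B"] fin by blast
  define \<sigma> where "\<sigma> P v = (\<Sum>u\<in>P. adj G v u)" for P v
  have un: "\<sigma> (P \<union> Q) v = \<sigma> P v + \<sigma> Q v"
    if "P \<subseteq> A \<union> B" "Q \<subseteq> A \<union> B" "P \<inter> Q = {}" for P Q v
    unfolding \<sigma>_def using that fin by (intro sum.union_disjoint) (auto intro: finite_subset)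
  have \<sigma>A: "\<sigma> A v = \<sigma> (A - E) v + \<sigma> (A \<inter> E) v" for v
    using un[of "A - E" "A \<inter> E" v] by (auto simp: Un_Diff_Int)
  have \<sigma>B: "\<sigma> B v = \<sigma> (B - E) v + \<sigma> (B \<inter> E) v" for v
    using un[of "B - E" "B \<inter> E" v] by (auto simp: Un_Diff_Int)
  have \<sigma>E: "\<sigma> E v = \<sigma> (A \<inter> E) v + \<sigma> (B \<inter> E) v" for v
    using un[of "A \<inter> E" "B \<inter> E" v] E(1) disj by (auto simp: Int_Un_distrib2[symmetric] Int_absorb1)
  have \<sigma>C: "\<sigma> (A \<union> B - E) v = \<sigma> (A - E) v + \<sigma> (B - E) v" for v
    using un[of "A - E" "B - E" v] disj by (auto simp: Un_Diff)
  define S1 where "S1 = (A - E) \<union> (B \<inter> E)"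
  define S2 where "S2 = (A \<inter> E) \<union> (B - E)"
  have \<sigma>S1: "\<sigma> S1 v = \<sigma> (A - E) v + \<sigma> (B \<inter> E) v" for v
    unfolding S1_def using disj by (intro un) auto
  have \<sigma>S2: "\<sigma> S2 v = \<sigma> (A \<inter> E) v + \<sigma> (B - E) v" for v
    unfolding S2_def using disj by (intro un) auto
  \<comment> \<open>For \<open>v \<in> B \<inter> E\<close>, evenness of \<open>E\<close> lets
    \<open>B \<inter> E\<close> replace \<open>A \<inter> E\<close>, turning \<open>A\<close> into
    \<open>S1\<close>. For \<open>v \<in> A - E\<close>, evenness of the complement turns
    \<open>B\<close> into \<open>S1\<close>.\<close>
  have 1: "\<sigma> S1 v = l v" if "v \<in> S1" for v
  proof (cases "v \<in> E")
    case True
    then have "v \<in> B" using that by (auto simp: S1_def)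
    then show ?thesis using B[of v] E(2)[OF True] \<sigma>A[of v] \<sigma>E[of v] \<sigma>S1[of v]
      unfolding \<sigma>_def[symmetric]
      by (cases "\<sigma> (A - E) v"; cases "\<sigma> (A \<inter> E) v"; cases "\<sigma> (B \<inter> E) v") auto
  next
    case False
    then have "v \<in> A" using that by (auto simp: S1_def)
    then show ?thesis using A[of v] E(3)[of v] False \<sigma>B[of v] \<sigma>C[of v] \<sigma>S1[of v]
      unfolding \<sigma>_def[symmetric]
      by (cases "\<sigma> (A - E) v"; cases "\<sigma> (B - E) v"; cases "\<sigma> (B \<inter> E) v") auto
  qed
  have 2: "\<sigma> S2 v = l v" if "v \<in> S2" for v
  proof (cases "v \<in> E")
    case True
    then have "v \<in> A" using that by (auto simp: S2_def)
    then show ?thesis using A[of v] E(2)[OF True] \<sigma>B[of v] \<sigma>E[of v] \<sigma>S2[of v]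
      unfolding \<sigma>_def[symmetric]
      by (cases "\<sigma> (B - E) v"; cases "\<sigma> (A \<inter> E) v"; cases "\<sigma> (B \<inter> E) v") auto
  next
    case False
    then have "v \<in> B" using that by (auto simp: S2_def)
    then show ?thesis using B[of v] E(3)[of v] False \<sigma>A[of v] \<sigma>C[of v] \<sigma>S2[of v]
      unfolding \<sigma>_def[symmetric]
      by (cases "\<sigma> (A - E) v"; cases "\<sigma> (B - E) v"; cases "\<sigma> (A \<inter> E) v") auto
  qed
  have fS: "finite S1" "finite S2" using fin by (auto simp: S1_def S2_def)
  have "admissible l G S1"
    using 1 sub fS unfolding admissible_def \<sigma>_def by (auto simp: of_nat_deg_in S1_def)
  moreover have "admissible l G S2"
    using 2 sub fS unfolding admissible_def \<sigma>_def by (auto simp: of_nat_deg_in S2_def)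
  moreover have "card S1 + card S2 = card A + card B"
  proof -
    have "card S1 + card S2 = card (S1 \<union> S2)"
      using disj fS by (intro card_Un_disjoint[symmetric]) (auto simp: S1_def S2_def)
    also have "S1 \<union> S2 = A \<union> B" by (auto simp: S1_def S2_def)
    also have "card (A \<union> B) = card A + card B" using fin disj by (rule card_Un_disjoint)
    finally show ?thesis .
  qed
  ultimately show ?thesis using admissible_card_le[of l S1] admissible_card_le[of l S2] by linarith
qed

lemma correct_parity_card_le:
  assumes W: "W \<subseteq> pverts G" and T: "T \<subseteq> pverts G" and disj: "W \<inter> T = {}"
    and par: "\<And>w. w \<in> W \<Longrightarrow> (\<Sum>t\<in>T. adj G w t) = l w"
  shows "card W \<le> 2 * h_num l G"
proof -
  define P where "P R \<longleftrightarrow> R \<subseteq> T \<and> (\<forall>w\<in>W. (\<Sum>t\<in>R. adj G w t) = l w)" for R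
  have fT: "finite T" and fW: "finite W"
    using T W pair_finite_verts by (auto intro: finite_subset)
  have "P T" using par by (simp add: P_def)
  then obtain U where U: "P U" and min: "\<And>R. P R \<Longrightarrow> card U \<le> card R"
    using arg_min_nat_lemma[of P T card] by metis
  have UT: "U \<subseteq> T" and Upar: "\<And>w. w \<in> W \<Longrightarrow> (\<Sum>t\<in>U. adj G w t) = l w"
    using U by (auto simp: P_def)
  have fU: "finite U" using UT fT by (rule finite_subset)
  \<comment> \<open>If the rows in \<open>R\<close> cancelled on \<open>W\<close>, then
    \<open>U - R\<close> would also be right for \<open>W\<close>, against the minimality of
    \<open>U\<close>.\<close>
  have indep: "\<exists>w\<in>W. (\<Sum>t\<in>R. adj G t w) \<noteq> 0" if R: "R \<subseteq> U" "R \<noteq> {}" for R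
  proof (rule ccontr)
    assume "\<not> (\<exists>w\<in>W. (\<Sum>t\<in>R. adj G t w) \<noteq> 0)"
    then have zero: "(\<Sum>t\<in>R. adj G w t) = 0" if "w \<in> W" for w
      using that by (simp add: adj_sym[of w])
    have "(\<Sum>t\<in>U - R. adj G w t) = l w" if "w \<in> W" for w
      using sum.subset_diff[OF R(1) fU, of "adj G w"] zero[OF that] Upar[OF that] by simp
    then have "P (U - R)" using UT by (auto simp: P_def)
    then have "card U \<le> card (U - R)" by (rule min)
    moreover have "card (U - R) < card U" using R fU by (intro psubset_card_mono) auto
    ultimately show False by simp
  qed
  \<comment> \<open>The right-hand side is the parity defect of \<open>t\<close> towards
    \<open>W\<close>, which deleting \<open>B\<close> from \<open>W\<close> removes.\<close>
  from independent_rows_column_span[OF fU fW indep, of "\<lambda>t. l t + (\<Sum>w\<in>W. adj G t w)"]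
  obtain B where B: "B \<subseteq> W" "card B \<le> card U"
    "\<And>t. t \<in> U \<Longrightarrow> (\<Sum>w\<in>B. adj G t w) = l t + (\<Sum>w\<in>W. adj G t w)"
    by blast
  have "(\<Sum>w\<in>W - B. adj G t w) = l t" if "t \<in> U" for t
    using B(3)[OF that] sum.subset_diff[OF B(1) fW, of "adj G t"]
    by (simp add: add.left_commute bit_add_eq_0_iff)
  \<comment> \<open>Counting \<open>U\<close> offsets the at most \<open>card U\<close> deleted
    vertices.\<close>
  then have "card (W - B) + card U \<le> 2 * h_num l G"
    using W T UT disj Upar by (intro balanced_pair_card_le) auto
  moreover have "card W - card B \<le> card (W - B)"
    using B(1) fW by (intro diff_card_le_card_Diff) (auto intro: finite_subset)
  ultimately show ?thesis using B(2) by linarith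
qed

section \<open>Dominating sets\<close>

text \<open>A uniformly random \<open>T\<close> is right for each \<open>w\<close> with probability
  1/2. The induction decides one vertex at a time: adding \<open>d\<close> or not matters only for
  the neighbours of \<open>d\<close>.\<close>

lemma ex_subset_half_correct_parity:
  assumes "finite D" and "finite W"
    and "\<And>w. w \<in> W \<Longrightarrow> \<exists>d\<in>D. adj G w d \<noteq> 0"
  shows "\<exists>T\<subseteq>D. card W \<le> 2 * card {w\<in>W. (\<Sum>t\<in>T. adj G w t) = l w}"
  using assms
proof (induction D arbitrary: W rule: finite_induct)
  case empty
  then have "W = {}" by auto
  then show ?case by auto
next
  case (insert d D)
  define X where "X = {w\<in>W. adj G w d = 0}"
  define Y where "Y = {w\<in>W. adj G w d \<noteq> 0}"
  have fin: "finite X" "finite Y" using insert.prems(1) by (auto simp: X_def Y_def)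
  have W: "W = X \<union> Y" "X \<inter> Y = {}" by (auto simp: X_def Y_def)
  have "\<exists>d'\<in>D. adj G w d' \<noteq> 0" if "w \<in> X" for w
    using insert.prems(2)[of w] that by (auto simp: X_def)
  from insert.IH[OF fin(1) this] obtain T where T: "T \<subseteq> D"
    "card X \<le> 2 * card {w\<in>X. (\<Sum>t\<in>T. adj G w t) = l w}" by blast
  have dT: "finite T" "d \<notin> T" using T(1) insert.hyps by (auto intro: finite_subset)
  define Y1 where "Y1 = {w\<in>Y. (\<Sum>t\<in>T. adj G w t) = l w}"
  define Y2 where "Y2 = {w\<in>Y. (\<Sum>t\<in>insert d T. adj G w t) = l w}"
  \<comment> \<open>Adding \<open>d\<close> flips the parity at each vertex of \<open>Y\<close>, so
    one of the two options is right for at least half of \<open>Y\<close>.\<close>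
  have "Y = Y1 \<union> Y2"
  proof -
    have bit: "x = y \<or> 1 + x = y" for x y :: bit
      by (cases x; cases y) auto
    show ?thesis using dT bit by (fastforce simp: Y1_def Y2_def Y_def)
  qed
  then have "card Y \<le> card Y1 + card Y2" by (simp add: card_Un_le)
  then have "card Y \<le> 2 * card Y1 \<or> card Y \<le> 2 * card Y2" by linarith
  then obtain T' where T': "T' = T \<or> T' = insert d T"
    "card Y \<le> 2 * card {w\<in>Y. (\<Sum>t\<in>T'. adj G w t) = l w}"
    unfolding Y1_def Y2_def by blast
  have "(\<Sum>t\<in>T'. adj G w t) = (\<Sum>t\<in>T. adj G w t)" if "w \<in> X" for w
    using T'(1) that dT by (auto simp: X_def)
  then have "{w\<in>X. (\<Sum>t\<in>T'. adj G w t) = l w} = {w\<in>X. (\<Sum>t\<in>T. adj G w t) = l w}" by auto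
  with T(2) have "card X \<le> 2 * card {w\<in>X. (\<Sum>t\<in>T'. adj G w t) = l w}" by simp
  moreover have "card {w\<in>W. (\<Sum>t\<in>T'. adj G w t) = l w} =
      card {w\<in>X. (\<Sum>t\<in>T'. adj G w t) = l w} + card {w\<in>Y. (\<Sum>t\<in>T'. adj G w t) = l w}"
    using fin W by (subst card_Un_disjoint[symmetric]) (auto intro!: arg_cong[of _ _ card])
  moreover have "card W = card X + card Y" unfolding W(1) using fin W(2) by (rule card_Un_disjoint)
  moreover have "T' \<subseteq> insert d D" using T'(1) T(1) by auto
  ultimately show ?case using T'(2) by (intro exI[of _ T']) auto
qed

lemma card_diff_dominating_le:
  assumes D: "dominating G D"
  shows "card (pverts G) - card D \<le> 4 * h_num l G"
proof -
  have sub: "D \<subseteq> pverts G" using D by (simp add: dominating_def)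
  have fD: "finite D" using sub pair_finite_verts by (rule finite_subset)
  define W where "W = pverts G - D"
  have "\<exists>d\<in>D. adj G w d \<noteq> 0" if "w \<in> W" for w
    using D that unfolding dominating_def W_def nbhd_def adj_def by fastforce
  then obtain T where T: "T \<subseteq> D"
    "card W \<le> 2 * card {w\<in>W. (\<Sum>t\<in>T. adj G w t) = l w}"
    using ex_subset_half_correct_parity[OF fD, of W l] by (auto simp: W_def)
  have "card {w\<in>W. (\<Sum>t\<in>T. adj G w t) = l w} \<le> 2 * h_num l G"
    using T(1) sub by (intro correct_parity_card_le[of _ T]) (auto simp: W_def)
  moreover have "card W = card (pverts G) - card D"
    unfolding W_def by (rule card_Diff_subset[OF fD sub])
  ultimately show ?thesis using T(2) by linarith
qed

lemma nbhd_sym: "u \<in> nbhd G v \<longleftrightarrow> v \<in> nbhd G u"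
  by (auto simp: nbhd_def arcs_symmetric)

lemma nbhd_subset: "nbhd G v \<subseteq> pverts G"
  by (auto simp: nbhd_def dest: in_arcsD2)

lemma not_in_nbhd_self [simp]: "v \<notin> nbhd G v"
  by (auto simp: nbhd_def dest: no_loops')

text \<open>Bollobas and Cockayne. Among the minimum dominating sets, take one with the fewest isolated
  vertices in the subgraph it induces.\<close>

lemma ex_min_dominating_private_nbrs:
  assumes noiso: "\<not> (\<exists>v. isolated G v)"
  shows "\<exists>D. dominating G D \<and> card D = domination_number G \<and>
    (\<forall>d\<in>D. \<exists>p\<in>pverts G - D. nbhd G p \<inter> D = {d})"
proof -
  define P where "P D \<longleftrightarrow> dominating G D \<and> card D = domination_number G" for D
  define iso where "iso D = {d\<in>D. nbhd G d \<inter> D = {}}" for D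
  obtain D where PD: "P D" and min: "\<And>D'. P D' \<Longrightarrow> card (iso D) \<le> card (iso D')"
    using domination_number_attained ex_has_least_nat[of P _ "\<lambda>D. card (iso D)"]
    unfolding P_def by blast
  have dom: "dominating G D" and cD: "card D = domination_number G" using PD by (auto simp: P_def)
  have sub: "D \<subseteq> pverts G" using dom by (simp add: dominating_def)
  have fD: "finite D" using sub pair_finite_verts by (rule finite_subset)
  have "\<exists>p\<in>pverts G - D. nbhd G p \<inter> D = {d}" if d: "d \<in> D" for d
  proof (rule ccontr)
    assume "\<not> (\<exists>p\<in>pverts G - D. nbhd G p \<inter> D = {d})"
    then have other: "nbhd G v \<inter> (D - {d}) \<noteq> {}" if "v \<in> pverts G - D" for v
      using dom that unfolding dominating_def by blast
    \<comment> \<open>With a neighbour of \<open>d\<close> in \<open>D\<close>, the set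
      \<open>D - {d}\<close> would still dominate.\<close>
    have diso: "nbhd G d \<inter> D = {}"
    proof (rule ccontr)
      assume "nbhd G d \<inter> D \<noteq> {}"
      then have "dominating G (D - {d})"
        using other sub unfolding dominating_def by fastforce
      then have "domination_number G \<le> card (D - {d})" by (rule domination_number_le)
      moreover have "card (D - {d}) < card D" using fD d by (rule card_Diff1_less)
      ultimately show False using cD by simp
    qed
    obtain u where u: "u \<in> nbhd G d" using noiso d sub by (auto simp: isolated_def)
    have uV: "u \<in> pverts G - D" using u diso nbhd_subset by auto
    define D' where "D' = insert u (D - {d})"
    have du: "d \<in> nbhd G u" using u by (simp add: nbhd_sym)
    have "nbhd G v \<inter> D' \<noteq> {}" if "v \<in> pverts G - D'" for v
      using that other[of v] u by (cases "v = d") (auto simp: D'_def)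
    then have "dominating G D'" using uV sub by (auto simp: dominating_def D'_def)
    moreover have "card D' = card D"
      using uV fD card_Suc_Diff1[OF fD d] by (simp add: D'_def card_insert_if del: card_Diff_singleton)
    ultimately have "P D'" using cD by (simp add: P_def)
    \<comment> \<open>The exchange drops \<open>d\<close>; the new vertex \<open>u\<close> has a
      neighbour in \<open>D - {d}\<close>, and no other vertex loses one, since \<open>d\<close> had
      none in \<open>D\<close>.\<close>
    moreover have "iso D' \<subset> iso D"
    proof (rule psubsetI)
      have "x \<in> iso D" if x: "x \<in> iso D'" for x
      proof -
        have "x \<noteq> u" using x other[OF uV] by (auto simp: iso_def D'_def)
        then have "x \<in> D - {d}" using x by (auto simp: iso_def D'_def)
        moreover have "d \<notin> nbhd G x" using diso nbhd_sym calculation by blast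
        ultimately show ?thesis using x by (auto simp: iso_def D'_def)
      qed
      then show "iso D' \<subseteq> iso D" by blast
      have "d \<in> iso D" "d \<notin> iso D'" using d diso uV by (auto simp: iso_def D'_def)
      then show "iso D' \<noteq> iso D" by blast
    qed
    then have "card (iso D') < card (iso D)" using fD by (intro psubset_card_mono) (auto simp: iso_def)
    ultimately show False using min[of D'] by simp
  qed
  then show ?thesis using dom cD by blast
qed

lemma domination_number_le_h_num:
  assumes "\<not> (\<exists>v. isolated G v)"
  shows "domination_number G \<le> 2 * h_num l G"
proof -
  obtain D where D: "dominating G D" "card D = domination_number G"
    "\<And>d. d \<in> D \<Longrightarrow> \<exists>p\<in>pverts G - D. nbhd G p \<inter> D = {d}"
    using ex_min_dominating_private_nbrs[OF assms] by blast
  then obtain p where p: "\<And>d. d \<in> D \<Longrightarrow> p d \<in> pverts G - D"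
    "\<And>d. d \<in> D \<Longrightarrow> nbhd G (p d) \<inter> D = {d}" by metis
  have sub: "D \<subseteq> pverts G" using D(1) by (simp add: dominating_def)
  have fD: "finite D" using sub pair_finite_verts by (rule finite_subset)
  \<comment> \<open>Within \<open>D\<close>, the vertex \<open>p d\<close> sees only
    \<open>d\<close>, so membership of \<open>d\<close> alone sets its parity.\<close>
  define T where "T = {d\<in>D. l (p d) = 1}"
  have fT: "finite T" using fD by (simp add: T_def)
  have "(\<Sum>t\<in>T. adj G (p d) t) = l (p d)" if "d \<in> D" for d
  proof -
    have "adj G (p d) t = (if t = d then 1 else 0)" if "t \<in> T" for t
      using p(2)[OF \<open>d \<in> D\<close>] that by (auto simp: adj_def nbhd_def T_def)
    then have "(\<Sum>t\<in>T. adj G (p d) t) = (if d \<in> T then 1 else 0)" using fT by simp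
    then show ?thesis using that by (cases "l (p d)") (auto simp: T_def)
  qed
  then have "card (p ` D) \<le> 2 * h_num l G"
    using p(1) sub by (intro correct_parity_card_le[of _ T]) (auto simp: T_def)
  moreover have "inj_on p D" by (rule inj_onI) (metis p(2) singleton_inject)
  ultimately show ?thesis using D(2) by (simp add: card_image)
qed

end

theorem theorem9:
  fixes G :: "'a pair_pre_digraph" and n :: nat and l :: "'a \<Rightarrow> bit"
  assumes "pair_graph G"
    and "card (pverts G) = n"
    and "\<not> (\<exists>v. isolated G v)"
  shows "real (h_num l G) \<ge>
           max (real (domination_number G) / 2) ((real n - real (domination_number G)) / 4)
         \<and> real (h_num l G) \<ge> real n / 6
         \<and> real (f_oe G) \<ge> real n / 6"
proof -
  interpret pair_graph G by (rule assms(1))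
  obtain D where D: "dominating G D" "card D = domination_number G"
    using domination_number_attained by blast
  \<comment> \<open>The labelling stays arbitrary, to serve both \<open>l\<close> and the one
    attaining \<open>f_oe G\<close>.\<close>
  have a: "domination_number G \<le> 2 * h_num k G" for k
    using assms(3) by (rule domination_number_le_h_num)
  have b: "n - domination_number G \<le> 4 * h_num k G" for k
    using card_diff_dominating_le[OF D(1), of k] D(2) assms(2) by simp
  have c: "n \<le> 6 * h_num k G" for k
    using a[of k] b[of k] by linarith
  obtain k where "h_num k G = f_oe G" using f_oe_attained by blast
  then show ?thesis using a[of l] b[of l] c[of l] c[of k] by auto
qed

end
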